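(* Let $\mathbb{F}$ be a field of characteristic different from $2$ and $G\leq\mathrm{GL}_n(\mathbb{F})$ a reflection group acting on $V=\mathbb{F}^n$. Suppose $\omega_1,\dots,\omega_n$ are $G$-invariant differential $1$-forms with $$\omega_1\wedge\cdots\wedge\omega_n = c\,Q(\tilde{\mathcal A})\,Q_{\det}\,dz_1\wedge\cdots\wedge dz_n$$ for some $c\in\mathbb{F}^\times$. Then $\omega_1,\dots,\omega_n$ is a basis of $(\Omega^1)^G$ as a free module over $\mathbb{F}[V]^G$: $(\Omega^1)^G=\bigoplus_i\mathbb{F}[V]^G\,\omega_i$.
   Context: $\mathbb{F}[V]=S(V^* )$; $z_1,\dots,z_n$ is a basis of $V^*$; $\Omega^1=\mathbb{F}[V]\otimes V^*$, with $G$ acting on $V^*$ by $(gf)(v)=f(g^{-1}v)$ and diagonally on forms; $(\Omega^1)^G$ is the set of invariant $1$-forms. A reflection is a finite-order element of $\mathrm{GL}(V)$ whose fixed space is a hyperplane; a reflection group is a finite group generated by reflections. For a hyperplane $H$ with defining linear form $l_H$, a reflection $s$ about $H$ satisfies $s(v)=v+l_H(v)\alpha_s$ (root vector $\alpha_s$); it is a transvection if $\alpha_s\in H$. $\mathcal A$ is the set of reflecting hyperplanes of reflections in $G$. For $H\in\mathcal A$: $G_H$ is the pointwise stabilizer of $H$ in $G$, $K_H=\ker(\det|_{G_H})$, $e_H=|G_H:K_H|$, and $b_H$ is the dimension of the span of the root vectors of transvections in $G_H$. Define $Q_{\det}=\prod_{H\in\mathcal A}l_H^{e_H-1}$ and $Q(\tilde{\mathcal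 A})=\prod_{H\in\mathcal A}l_H^{e_Hb_H}$. *)

theory Defs
  imports "HOL-Analysis.Analysis" "HOL-Library.Poly_Mapping"
begin

type_synonym ('a, 'n) mpoly = "('n \<Rightarrow>\<^sub>0 nat) \<Rightarrow>\<^sub>0 'a"

definition zvar :: "'n \<Rightarrow> ('a::comm_ring_1, 'n) mpoly" where
  "zvar k = Poly_Mapping.single (Poly_Mapping.single k 1) 1"

definition pconst :: "'a::comm_ring_1 \<Rightarrow> ('a, 'n) mpoly" where
  "pconst c = Poly_Mapping.single 0 c"

definition psubst :: "('n::finite \<Rightarrow> ('a::comm_ring_1, 'n) mpoly) \<Rightarrow> ('a, 'n) mpoly \<Rightarrow> ('a, 'n) mpoly" where
  "psubst \<sigma> f = (\<Sum>mo\<in>Poly_Mapping.keys f. pconst (Poly_Mapping.lookup f mo) * (\<Prod>k\<in>UNIV. (\<sigma> k) ^ (Poly_Mapping.lookup (mo :: 'n \<Rightarrow>\<^sub>0 nat) k)))"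

definition lform :: "'a::comm_ring_1^'n::finite \<Rightarrow> 'a^'n \<Rightarrow> 'a" where
  "lform l v = (\<Sum>i\<in>UNIV. l $ i * v $ i)"

definition lpoly :: "'a::comm_ring_1^'n::finite \<Rightarrow> ('a, 'n) mpoly" where
  "lpoly l = (\<Sum>i\<in>UNIV. pconst (l $ i) * zvar i)"

text \<open>action of g on F[V]: (g f)(v) = f(g^{-1} v), i.e. z_j is replaced by z_j o g^{-1}\<close>
definition pact :: "'a::field^'n::finite^'n \<Rightarrow> ('a, 'n) mpoly \<Rightarrow> ('a, 'n) mpoly" where
  "pact g f = psubst (\<lambda>j. lpoly (row j (matrix_inv g))) f"

text \<open>1-forms: Omega^1 = F[V] (x) V^*, a form is sum_j w_j dz_j, stored as j \<mapsto> w_j.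
  g acts diagonally: g(f dz_j) = (g f) (z_j o g^{-1}) and z_j o g^{-1} = sum_k (g^{-1})_{jk} z_k.\<close>
type_synonym ('a, 'n) form1 = "'n \<Rightarrow> ('a, 'n) mpoly"

definition fact1 :: "'a::field^'n::finite^'n \<Rightarrow> ('a, 'n) form1 \<Rightarrow> ('a, 'n) form1" where
  "fact1 g w = (\<lambda>k. \<Sum>j\<in>UNIV. pact g (w j) * pconst (matrix_inv g $ j $ k))"

definition inv_poly :: "('a::field^'n::finite^'n) set \<Rightarrow> ('a, 'n) mpoly \<Rightarrow> bool" where
  "inv_poly G f \<longleftrightarrow> (\<forall>g\<in>G. pact g f = f)"

definition inv_form :: "('a::field^'n::finite^'n) set \<Rightarrow> ('a, 'n) form1 \<Rightarrow> bool" where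
  "inv_form G w \<longleftrightarrow> (\<forall>g\<in>G. fact1 g w = w)"

text \<open>omega_1 /\ ... /\ omega_n = det(coefficient matrix) dz_1 /\ ... /\ dz_n\<close>
definition wedge_coeff :: "('n::finite \<Rightarrow> ('a::field, 'n) form1) \<Rightarrow> ('a, 'n) mpoly" where
  "wedge_coeff \<omega> = det (\<chi> i j. \<omega> i j)"

definition fixspace :: "'a::field^'n::finite^'n \<Rightarrow> ('a^'n) set" where
  "fixspace g = {v. g *v v = v}"

fun mat_pow :: "'a::field^'n::finite^'n \<Rightarrow> nat \<Rightarrow> 'a^'n^'n" where
  "mat_pow A 0 = mat 1"
| "mat_pow A (Suc k) = A ** mat_pow A k"

definition is_reflection :: "'a::field^'n::finite^'n \<Rightarrow> bool" where
  "is_reflection s \<longleftrightarrow> invertible s \<and> (\<exists>k>0. mat_pow s k = mat 1)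
      \<and> vec.dim (fixspace s) = CARD('n) - 1"

inductive_set gen_group :: "('a::field^'n::finite^'n) set \<Rightarrow> ('a^'n^'n) set" for S where
  gen_one: "mat 1 \<in> gen_group S"
| gen_mul: "s \<in> S \<Longrightarrow> x \<in> gen_group S \<Longrightarrow> s ** x \<in> gen_group S"
| gen_mul_inv: "s \<in> S \<Longrightarrow> x \<in> gen_group S \<Longrightarrow> matrix_inv s ** x \<in> gen_group S"

definition matrix_group :: "('a::field^'n::finite^'n) set \<Rightarrow> bool" where
  "matrix_group G \<longleftrightarrow> G \<noteq> {} \<and> (\<forall>g\<in>G. invertible g)
      \<and> (\<forall>g\<in>G. \<forall>h\<in>G. g ** h \<in> G) \<and> (\<forall>g\<in>G. matrix_inv g \<in> G)"

definition reflection_group :: "('a::field^'n::finite^'n) set \<Rightarrow> bool" where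
  "reflection_group G \<longleftrightarrow> finite G \<and> matrix_group G
      \<and> G = gen_group {s\<in>G. is_reflection s}"

definition refl_hyperplanes :: "('a::field^'n::finite^'n) set \<Rightarrow> ('a^'n) set set" where
  "refl_hyperplanes G = {fixspace s | s. s \<in> G \<and> is_reflection s}"

definition lH :: "('a::field^'n::finite) set \<Rightarrow> 'a^'n" where
  "lH H = (SOME l. l \<noteq> 0 \<and> H = {v. lform l v = 0})"

definition GH :: "('a::field^'n::finite^'n) set \<Rightarrow> ('a^'n) set \<Rightarrow> ('a^'n^'n) set" where
  "GH G H = {g\<in>G. \<forall>v\<in>H. g *v v = v}"

definition KH :: "('a::field^'n::finite^'n) set \<Rightarrow> ('a^'n) set \<Rightarrow> ('a^'n^'n) set" where
  "KH G H = {g\<in>GH G H. det g = 1}"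

definition eH :: "('a::field^'n::finite^'n) set \<Rightarrow> ('a^'n) set \<Rightarrow> nat" where
  "eH G H = card (GH G H) div card (KH G H)"

definition root_vec :: "('a::field^'n::finite) set \<Rightarrow> 'a^'n^'n \<Rightarrow> 'a^'n" where
  "root_vec H s = (THE \<alpha>. \<forall>v. s *v v = v + lform (lH H) v *s \<alpha>)"

definition is_transvection :: "('a::field^'n::finite) set \<Rightarrow> 'a^'n^'n \<Rightarrow> bool" where
  "is_transvection H s \<longleftrightarrow> is_reflection s \<and> fixspace s = H \<and> root_vec H s \<in> H"

definition bH :: "('a::field^'n::finite^'n) set \<Rightarrow> ('a^'n) set \<Rightarrow> nat" where
  "bH G H = vec.dim (vec.span {root_vec H s | s. s \<in> GH G H \<and> is_transvection H s})"

definition Q_det :: "('a::field^'n::finite^'n) set \<Rightarrow> ('a, 'n) mpoly" where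
  "Q_det G = (\<Prod>H\<in>refl_hyperplanes G. lpoly (lH H) ^ (eH G H - 1))"

definition Q_tilde :: "('a::field^'n::finite^'n) set \<Rightarrow> ('a, 'n) mpoly" where
  "Q_tilde G = (\<Prod>H\<in>refl_hyperplanes G. lpoly (lH H) ^ (eH G H * bH G H))"

end

theory Submission
  imports Defs
begin

text \<open>
  Fix a reflecting hyperplane \<open>H\<close> with linear form \<open>l\<close>, and write \<open>w(v)\<close> for the contraction of a
  1-form \<open>w\<close> with a constant vector \<open>v\<close>; invariance of \<open>w\<close> under \<open>g\<close> means \<open>w(g v) = g \<cdot> w(v)\<close>.
  Every \<open>g\<close> in \<open>G\<^sub>H\<close> acts trivially modulo \<open>l\<close> and multiplies \<open>l\<close> by \<open>(det g)\<^sup>-\<^sup>1\<close>, so the order of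
  vanishing along \<open>H\<close> of a semi-invariant of \<open>G\<^sub>H\<close> is determined modulo \<open>e\<^sub>H\<close> by its character.
  If \<open>\<alpha>\<close> is the root of a transvection \<open>s\<close> about \<open>H\<close>, then \<open>w(\<alpha>) = s \<cdot> w(u) - w(u)\<close> for \<open>l(u) = 1\<close>, which is
  divisible by \<open>l\<close>; being \<open>G\<^sub>H\<close>-invariant, it is divisible by \<open>l\<close> to the power \<open>e\<^sub>H\<close>. Hence \<open>b\<^sub>H\<close>
  independent columns contribute \<open>e\<^sub>H b\<^sub>H\<close> factors \<open>l\<close> to the coefficient of any
  \<open>\<omega>\<^sub>1 \<and> \<dots> \<and> \<omega>\<^sub>n\<close>, and since that coefficient is a semi-invariant of character \<open>det\<close>, there are at
  least \<open>e\<^sub>H - 1\<close> further ones. Linear forms are prime, so the product over all \<open>H\<close> divides the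
  coefficient of every such wedge of invariant forms, and Cramer's rule finishes the proof.
\<close>

section \<open>Polynomial rings\<close>

lemma poly_mapping_add_induct [case_names zero single add]:
  fixes f :: "'b \<Rightarrow>\<^sub>0 'c::comm_monoid_add"
  assumes "P 0" and "\<And>m c. P (Poly_Mapping.single m c)"
    and add: "\<And>f g. P f \<Longrightarrow> P g \<Longrightarrow> P (f + g)"
  shows "P f"
proof (induct f rule: Poly_Mapping.update_induct)
  case const
  then show ?case by (rule assms(1))
next
  case (update f a b)
  have "Poly_Mapping.update a b f = f + Poly_Mapping.single a b"
    using update(1)
    by (intro poly_mapping_eqI)
      (auto simp: lookup_update lookup_add lookup_single when_def in_keys_iff)
  then show ?case using update assms by simp
qed

text \<open>A ring map on coefficients and a monoid map on exponents combine into one ring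
  homomorphism. It serves both the embedding that excludes zero divisors and the substitution of
  polynomials.\<close>

locale monomial_evaluation =
  fixes C :: "'a::comm_ring_1 \<Rightarrow> 'b::comm_ring_1"
    and M :: "'m::comm_monoid_add \<Rightarrow> 'b"
  assumes C_add: "C (x + y) = C x + C y"
    and C_mult: "C (x * y) = C x * C y"
    and C_one: "C 1 = 1"
    and M_zero: "M 0 = 1"
    and M_add: "M (m + m') = M m * M m'"
begin

definition eval :: "('m \<Rightarrow>\<^sub>0 'a) \<Rightarrow> 'b" where
  "eval f = (\<Sum>m\<in>Poly_Mapping.keys f. C (Poly_Mapping.lookup f m) * M m)"

lemma C_zero: "C 0 = 0"
  using C_add[of 0 0] by simp

text \<open>Cancellation can shrink the support of \<open>f + g\<close>, so additivity needs a
  common, larger index set.\<close>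

lemma eval_superset:
  assumes "finite S" "Poly_Mapping.keys f \<subseteq> S"
  shows "eval f = (\<Sum>m\<in>S. C (Poly_Mapping.lookup f m) * M m)"
  unfolding eval_def
  by (rule sum.mono_neutral_left) (use assms in \<open>auto simp: C_zero in_keys_iff\<close>)

lemma eval_zero: "eval 0 = 0"
  by (simp add: eval_def)

lemma eval_single: "eval (Poly_Mapping.single m c) = C c * M m"
  by (subst eval_superset[of "{m}"]) auto

lemma eval_add: "eval (f + g) = eval f + eval g"
proof -
  let ?S = "Poly_Mapping.keys f \<union> Poly_Mapping.keys g"
  have "eval h = (\<Sum>m\<in>?S. C (Poly_Mapping.lookup h m) * M m)" if "h \<in> {f, g, f + g}" for h
    by (rule eval_superset) (use that Poly_Mapping.keys_add[of f g] in auto)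
  then show ?thesis
    by (simp add: lookup_add C_add distrib_right sum.distrib)
qed

lemma eval_one: "eval 1 = 1"
  using eval_single[of 0 1] by (simp add: C_one M_zero)

text \<open>Both sides are biadditive in \<open>f\<close> and \<open>g\<close>, so comparing single
  monomials suffices.\<close>

lemma eval_mult: "eval (f * g) = eval f * eval g"
proof (induct f rule: poly_mapping_add_induct)
  case (single m c)
  show ?case
    by (induct g rule: poly_mapping_add_induct)
      (simp_all add: eval_zero eval_single eval_add mult_single C_mult M_add algebra_simps)
qed (simp_all add: eval_zero eval_add algebra_simps)

end

lemma pconst_add: "pconst (x + y) = pconst x + pconst y"
  by (simp add: pconst_def single_add)

lemma pconst_mult: "pconst (x * y) = pconst x * pconst y"
  by (simp add: pconst_def mult_single)

lemma pconst_zero: "pconst 0 = 0"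
  by (simp add: pconst_def)

lemma pconst_one: "pconst 1 = 1"
  by (simp add: pconst_def)

lemma pconst_eq_0_iff: "pconst x = 0 \<longleftrightarrow> x = 0"
  unfolding pconst_def by (metis lookup_single_eq lookup_zero single_zero)

lemma pconst_sum: "pconst (sum f A) = (\<Sum>i\<in>A. pconst (f i))"
  by (induct A rule: infinite_finite_induct) (auto simp: pconst_zero pconst_add)

lemma pconst_prod: "pconst (prod f A) = (\<Prod>i\<in>A. pconst (f i))"
  by (induct A rule: infinite_finite_induct) (auto simp: pconst_one pconst_mult)

lemma pconst_uminus: "pconst (- x) = - pconst x"
  by (simp add: pconst_def single_uminus)

lemma pconst_diff: "pconst (x - y) = pconst x - pconst y"
  by (simp add: pconst_def single_diff)

lemma pconst_of_int: "pconst (of_int z) = of_int z"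
  by (simp add: pconst_def)

lemma pconst_power: "pconst (x ^ k) = pconst x ^ k"
  by (induct k) (auto simp: pconst_one pconst_mult)

lemma pconst_inverse_cancel:
  "(x::'a::field) \<noteq> 0 \<Longrightarrow> pconst x * (pconst (inverse x) * f) = f"
  by (simp add: pconst_mult[symmetric] mult.assoc[symmetric] pconst_one)

text \<open>The library makes polynomial rings integral domains only for linearly ordered monomials;
  numbering the variables embeds into such a ring.\<close>

lemma mpoly_no_zero_divisors:
  fixes f g :: "('a::idom, 'n::finite) mpoly"
  assumes "f * g = 0"
  shows "f = 0 \<or> g = 0"
proof -
  obtain h :: "'n \<Rightarrow> nat" where h: "inj h"
    using finite_imp_inj_to_nat_seg[OF finite_class.finite_UNIV] by metis
  define \<iota> :: "('n \<Rightarrow>\<^sub>0 nat) \<Rightarrow> (nat \<Rightarrow>\<^sub>0 nat)"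
    where "\<iota> m = (\<Sum>k\<in>UNIV. Poly_Mapping.single (h k) (Poly_Mapping.lookup m k))" for m
  have \<iota>_lookup: "Poly_Mapping.lookup (\<iota> m) (h k) = Poly_Mapping.lookup m k" for m k
    by (simp add: \<iota>_def lookup_sum lookup_single when_def inj_eq[OF h])
  have \<iota>_inj: "inj \<iota>"
    by (rule injI, rule poly_mapping_eqI) (metis \<iota>_lookup)
  interpret monomial_evaluation "Poly_Mapping.single 0 :: 'a \<Rightarrow> (nat \<Rightarrow>\<^sub>0 nat) \<Rightarrow>\<^sub>0 'a"
    "\<lambda>m. Poly_Mapping.single (\<iota> m) 1"
    by unfold_locales
      (auto simp: single_add mult_single \<iota>_def lookup_add sum.distrib)
  have "Poly_Mapping.lookup (eval f) (\<iota> m) = Poly_Mapping.lookup f m" for f m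
    by (induct f rule: poly_mapping_add_induct)
      (auto simp: eval_zero eval_add lookup_add eval_single mult_single lookup_single when_def
        inj_eq[OF \<iota>_inj])
  then have "eval f = 0 \<Longrightarrow> f = 0" for f
    by (intro poly_mapping_eqI) (metis lookup_zero)
  moreover have "eval f * eval g = 0"
    using assms by (simp add: eval_zero flip: eval_mult)
  ultimately show ?thesis by auto
qed

lemma mpoly_mult_left_cancel:
  fixes f g h :: "('a::idom, 'n::finite) mpoly"
  assumes "h \<noteq> 0" "h * f = h * g"
  shows "f = g"
  using mpoly_no_zero_divisors[of h "f - g"] assms by (simp add: algebra_simps)

lemma mpoly_power_nonzero:
  fixes f :: "('a::idom, 'n::finite) mpoly"
  shows "f \<noteq> 0 \<Longrightarrow> f ^ k \<noteq> 0"
  by (induct k) (auto dest: mpoly_no_zero_divisors)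

lemma mpoly_prod_nonzero:
  fixes f :: "'b \<Rightarrow> ('a::idom, 'n::finite) mpoly"
  shows "(\<And>x. x \<in> A \<Longrightarrow> f x \<noteq> 0) \<Longrightarrow> prod f A \<noteq> 0"
  by (induct A rule: infinite_finite_induct) (auto dest: mpoly_no_zero_divisors)

section \<open>Substitution as a ring homomorphism\<close>

lemma monomial_evaluation_psubst:
  "monomial_evaluation (pconst :: 'a::comm_ring_1 \<Rightarrow> ('a, 'n::finite) mpoly)
     (\<lambda>m. \<Prod>k\<in>UNIV. \<sigma> k ^ Poly_Mapping.lookup m k)"
  by unfold_locales
    (auto simp: pconst_add pconst_mult pconst_one lookup_add power_add prod.distrib)

lemma psubst_eq_eval:
  "psubst \<sigma> = monomial_evaluation.eval pconst (\<lambda>m. \<Prod>k\<in>UNIV. \<sigma> k ^ Poly_Mapping.lookup m k)"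
  by (rule ext) (simp add: psubst_def monomial_evaluation.eval_def[OF monomial_evaluation_psubst])

lemma psubst_zero: "psubst \<sigma> 0 = 0"
  by (simp add: psubst_eq_eval monomial_evaluation.eval_zero[OF monomial_evaluation_psubst])

lemma psubst_one: "psubst \<sigma> 1 = 1"
  by (simp add: psubst_eq_eval monomial_evaluation.eval_one[OF monomial_evaluation_psubst])

lemma psubst_add: "psubst \<sigma> (f + g) = psubst \<sigma> f + psubst \<sigma> g"
  by (simp add: psubst_eq_eval monomial_evaluation.eval_add[OF monomial_evaluation_psubst])

lemma psubst_mult: "psubst \<sigma> (f * g) = psubst \<sigma> f * psubst \<sigma> g"
  by (simp add: psubst_eq_eval monomial_evaluation.eval_mult[OF monomial_evaluation_psubst])

lemma psubst_single:
  "psubst \<sigma> (Poly_Mapping.single m c) = pconst c * (\<Prod>k\<in>UNIV. \<sigma> k ^ Poly_Mapping.lookup m k)"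
  by (simp add: psubst_eq_eval monomial_evaluation.eval_single[OF monomial_evaluation_psubst])

lemma psubst_sum: "psubst \<sigma> (sum f A) = (\<Sum>i\<in>A. psubst \<sigma> (f i))"
  by (induct A rule: infinite_finite_induct) (auto simp: psubst_zero psubst_add)

lemma psubst_prod: "psubst \<sigma> (prod f A) = (\<Prod>i\<in>A. psubst \<sigma> (f i))"
  by (induct A rule: infinite_finite_induct) (auto simp: psubst_one psubst_mult)

lemma psubst_pconst: "psubst \<sigma> (pconst c) = pconst c"
  by (subst (1) pconst_def) (simp add: psubst_single)

lemma psubst_zvar: "psubst \<sigma> (zvar k) = \<sigma> k"
proof -
  have "(\<Prod>j\<in>UNIV. \<sigma> j ^ Poly_Mapping.lookup (Poly_Mapping.single k 1) j) = (\<Prod>j\<in>UNIV. if j = k then \<sigma> k else 1)"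
    by (rule prod.cong) (auto simp: lookup_single when_def)
  then show ?thesis
    by (simp add: zvar_def psubst_single pconst_one)
qed

lemma zvar_power: "zvar k ^ n = Poly_Mapping.single (Poly_Mapping.single k n) 1"
  by (induct n) (auto simp: zvar_def mult_single simp flip: single_add)

lemma prod_single: "(\<Prod>k\<in>A. Poly_Mapping.single (m k) (1::'a::comm_ring_1)) = Poly_Mapping.single (\<Sum>k\<in>A. m k) 1"
  by (induct A rule: infinite_finite_induct) (auto simp: mult_single)

lemma prod_zvar_power:
  "(\<Prod>k\<in>UNIV. zvar k ^ Poly_Mapping.lookup m k) = Poly_Mapping.single (m :: 'n::finite \<Rightarrow>\<^sub>0 nat) (1::'a::comm_ring_1)"
proof -
  have "(\<Sum>k\<in>UNIV. Poly_Mapping.single k (Poly_Mapping.lookup m k)) = m"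
    by (rule poly_mapping_eqI) (simp add: lookup_sum lookup_single when_def)
  then show ?thesis
    by (simp add: zvar_power prod_single)
qed

lemma single_eq_prod_zvar:
  "Poly_Mapping.single m c = pconst c * (\<Prod>k\<in>UNIV. zvar k ^ Poly_Mapping.lookup (m :: 'n::finite \<Rightarrow>\<^sub>0 nat) k)"
  by (simp add: prod_zvar_power pconst_def mult_single)

lemma dvd_prod_diff:
  fixes p :: "'b::comm_ring_1"
  assumes "\<And>k. k \<in> A \<Longrightarrow> p dvd f k - g k"
  shows "p dvd prod f A - prod g A"
  using assms
proof (induct A rule: infinite_finite_induct)
  case (insert x A)
  have "f x * prod f A - g x * prod g A = (f x - g x) * prod f A + g x * (prod f A - prod g A)"
    by (simp add: algebra_simps)
  then show ?case using insert by (simp add: dvd_mult dvd_mult2)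
qed auto

lemma dvd_power_diff:
  fixes p :: "'b::comm_ring_1"
  assumes "p dvd a - b"
  shows "p dvd a ^ n - b ^ n"
  using dvd_prod_diff[of "{..<n}" p "\<lambda>_. a" "\<lambda>_. b"] assms by simp

text \<open>A substitution that is trivial modulo \<open>p\<close> on variables is trivial modulo
  \<open>p\<close> everywhere; on a monomial the difference telescopes factor by factor.\<close>

lemma dvd_psubst_diff:
  assumes "\<And>k. p dvd \<sigma> k - zvar k"
  shows "p dvd psubst \<sigma> f - f"
proof (induct f rule: poly_mapping_add_induct)
  case (single m c)
  have "p dvd (\<Prod>k\<in>UNIV. \<sigma> k ^ Poly_Mapping.lookup m k) - (\<Prod>k\<in>UNIV. zvar k ^ Poly_Mapping.lookup m k)"
    by (intro dvd_prod_diff dvd_power_diff assms)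
  then show ?case
    by (subst (2) single_eq_prod_zvar) (simp add: psubst_single dvd_mult flip: right_diff_distrib)
next
  case (add f g)
  have "psubst \<sigma> (f + g) - (f + g) = (psubst \<sigma> f - f) + (psubst \<sigma> g - g)"
    by (simp add: psubst_add)
  then show ?case using add by (simp only: dvd_add)
qed (simp add: psubst_zero)

section \<open>Linear forms as prime polynomials\<close>

lemma psubst_lpoly: "psubst \<sigma> (lpoly l) = (\<Sum>i\<in>UNIV. pconst (l $ i) * \<sigma> i)"
  by (simp add: lpoly_def psubst_sum psubst_mult psubst_pconst psubst_zvar)

lemma lpoly_add: "lpoly (l + l') = lpoly l + lpoly l'"
  by (simp add: lpoly_def pconst_add distrib_right sum.distrib)

lemma lpoly_smult: "lpoly (c *s l) = pconst c * lpoly l"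
  by (simp add: lpoly_def pconst_mult sum_distrib_left mult.assoc)

lemma lpoly_axis: "lpoly (axis j 1) = zvar j"
proof -
  have "lpoly (axis j 1) = (\<Sum>i\<in>UNIV. if i = j then zvar j else 0)"
    unfolding lpoly_def by (rule sum.cong) (auto simp: axis_def pconst_zero pconst_one)
  then show ?thesis by simp
qed

lemma lookup_lpoly: "Poly_Mapping.lookup (lpoly l) (Poly_Mapping.single k 1) = l $ k"
proof -
  have "Poly_Mapping.single x (Suc 0) = Poly_Mapping.single k (Suc 0) \<longleftrightarrow> x = k" for x :: 'b
    by (metis lookup_single_eq lookup_single_not_eq nat.simps(3))
  then show ?thesis
    by (simp add: lpoly_def pconst_def zvar_def mult_single lookup_sum lookup_single when_def)
qed

lemma lpoly_inject: "lpoly l = lpoly l' \<longleftrightarrow> l = l'"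
  by (metis lookup_lpoly vec_eq_iff)

lemma lpoly_zero: "lpoly 0 = 0"
  by (simp add: lpoly_def pconst_zero)

text \<open>The substitution that solves \<open>l = 0\<close> for \<open>z\<^sub>k\<close> realises the quotient by \<open>l\<close>
  inside the polynomial ring itself.\<close>

lemma lpoly_elimination:
  fixes l :: "'a::field^'n::finite"
  assumes "l $ k \<noteq> 0"
  defines "\<sigma> \<equiv> \<lambda>j. if j = k then zvar k - pconst (inverse (l $ k)) * lpoly l else zvar j"
  shows "lpoly l dvd f \<longleftrightarrow> psubst \<sigma> f = 0"
    and "psubst \<sigma> (lpoly l') = lpoly (l' - (l' $ k / l $ k) *s l)"
proof -
  have eq: "psubst \<sigma> (lpoly l') = lpoly (l' - (l' $ k / l $ k) *s l)" for l'
  proof -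
    have "psubst \<sigma> (lpoly l') =
        (\<Sum>i\<in>UNIV. pconst (l' $ i) * zvar i - (if i = k then pconst (l' $ k / l $ k) * lpoly l else 0))"
      unfolding psubst_lpoly
      by (rule sum.cong) (auto simp: \<sigma>_def algebra_simps divide_inverse pconst_mult)
    also have "\<dots> = lpoly l' + lpoly ((- (l' $ k / l $ k)) *s l)"
      by (subst lpoly_smult) (simp add: sum_subtractf lpoly_def[of l'] pconst_uminus)
    also have "\<dots> = lpoly (l' - (l' $ k / l $ k) *s l)"
      by (subst lpoly_add[symmetric]) (simp add: vec_eq_iff)
    finally show ?thesis .
  qed
  show "psubst \<sigma> (lpoly l') = lpoly (l' - (l' $ k / l $ k) *s l)" by (rule eq)
  have zero: "psubst \<sigma> (lpoly l) = 0"
    using assms(1) by (simp add: eq lpoly_zero)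
  show "lpoly l dvd f \<longleftrightarrow> psubst \<sigma> f = 0"
  proof
    assume "lpoly l dvd f"
    then obtain h where "f = lpoly l * h" by (rule dvdE)
    then show "psubst \<sigma> f = 0" using zero by (simp add: psubst_mult)
  next
    assume "psubst \<sigma> f = 0"
    \<comment> \<open>\<open>\<sigma>\<close> moves only \<open>zvar k\<close>, and that by a
      multiple of \<open>lpoly l\<close>.\<close>
    moreover have "lpoly l dvd psubst \<sigma> f - f"
      by (rule dvd_psubst_diff) (simp add: \<sigma>_def)
    ultimately show "lpoly l dvd f" by simp
  qed
qed

text \<open>The multiples of \<open>lpoly l\<close> are the kernel of the elimination homomorphism,
  whose target is a domain.\<close>

lemma lpoly_dvd_mult:
  fixes l :: "'a::field^'n::finite"
  assumes "l \<noteq> 0" "lpoly l dvd f * g"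
  shows "lpoly l dvd f \<or> lpoly l dvd g"
proof -
  obtain k where "l $ k \<noteq> 0" using assms(1) by (auto simp: vec_eq_iff)
  from lpoly_elimination(1)[OF this] assms(2) show ?thesis
    by (auto simp: psubst_mult dest: mpoly_no_zero_divisors)
qed

text \<open>Elimination sends \<open>l'\<close> to a linear form, and a linear form is zero as a
  polynomial only if its coefficient vector is.\<close>

lemma lpoly_dvd_lpoly:
  fixes l l' :: "'a::field^'n::finite"
  assumes "l \<noteq> 0" "lpoly l dvd lpoly l'"
  obtains c where "l' = c *s l"
proof -
  obtain k where k: "l $ k \<noteq> 0" using assms(1) by (auto simp: vec_eq_iff)
  from lpoly_elimination[OF k] assms(2) have "lpoly (l' - (l' $ k / l $ k) *s l) = lpoly 0"
    by (simp add: lpoly_zero)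
  then show thesis using that by (simp add: lpoly_inject)
qed

section \<open>Cofactors, rank-one updates and hyperplanes\<close>

text \<open>Putting a unit vector into row \<open>i\<close> avoids minors, which would need an index
  type with one element removed, and signs.\<close>

definition cofactor :: "'a::comm_ring_1^'n::finite^'n \<Rightarrow> 'n \<Rightarrow> 'n \<Rightarrow> 'a" where
  "cofactor A i k = det (\<chi> r. if r = i then axis k 1 else A $ r)"

lemma det_replace_row:
  fixes A :: "'a::comm_ring_1^'n::finite^'n"
  shows "det (\<chi> r. if r = i then y else A $ r) = (\<Sum>k\<in>UNIV. y $ k * cofactor A i k)"
proof -
  have "y = (\<Sum>k\<in>UNIV. y $ k *s axis k 1)"
    by (simp add: vec_eq_iff axis_def if_distrib cong: if_cong)
  then have "det (\<chi> r. if r = i then y else A $ r)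
      = det (\<chi> r. if r = i then (\<Sum>k\<in>UNIV. y $ k *s axis k 1) else A $ r)"
    by (rule arg_cong)
  also have "\<dots> = (\<Sum>k\<in>UNIV. y $ k * cofactor A i k)"
    by (subst det_linear_row_sum) (simp_all add: det_row_mul cofactor_def)
  finally show ?thesis .
qed

text \<open>The sum expands \<open>A\<close> with row \<open>i\<close> overwritten by row
  \<open>r\<close>: either \<open>A\<close> itself or a matrix with two equal rows.\<close>

lemma sum_row_mult_cofactor:
  fixes A :: "'a::comm_ring_1^'n::finite^'n"
  shows "(\<Sum>k\<in>UNIV. A $ r $ k * cofactor A i k) = (if r = i then det A else 0)"
proof -
  have "(\<Sum>k\<in>UNIV. A $ r $ k * cofactor A i k) = det (\<chi> s. if s = i then A $ r else A $ s)"
    by (simp add: det_replace_row)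
  also have "\<dots> = (if r = i then det A else 0)"
  proof (cases "r = i")
    case True
    have "(\<chi> s. if s = i then A $ r else A $ s) = A"
      using True by (simp add: vec_eq_iff)
    with True show ?thesis by simp
  next
    case False
    then show ?thesis
      using det_identical_rows[of r i "\<chi> s. if s = i then A $ r else A $ s"]
      by (simp add: row_def)
  qed
  finally show ?thesis .
qed

text \<open>A unit vector in column \<open>k\<close> and one in row \<open>i\<close> give the same
  Leibniz terms: if \<open>p i = k\<close> the products coincide, otherwise each contains a zero
  factor.\<close>

lemma cofactor_transpose:
  fixes A :: "'a::comm_ring_1^'n::finite^'n"
  shows "cofactor (transpose A) k i = cofactor A i k"
proof -
  have "cofactor (transpose A) k i = det (\<chi> r c. if c = k then (if r = i then 1 else 0) else A $ r $ c)"
    unfolding cofactor_def by (subst det_transpose[symmetric], rule arg_cong[where f = det])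
      (simp add: vec_eq_iff transpose_def axis_def)
  also have "\<dots> = det (\<chi> r c. if r = i then (if c = k then 1 else 0) else A $ r $ c)"
    unfolding det_def
  proof (rule sum.cong[OF refl], rule arg_cong2[where f = "(*)"], rule refl)
    fix p :: "'n \<Rightarrow> 'n" assume "p \<in> {p. p permutes UNIV}"
    then have p: "bij p" by (simp add: permutes_bij)
    let ?R = "\<lambda>r. if p r = k then (if r = i then 1 else 0) else A $ r $ p r"
    let ?L = "\<lambda>r. if r = i then (if p r = k then 1 else 0) else A $ r $ p r"
    have "prod ?R UNIV = prod ?L UNIV"
    proof (cases "p i = k")
      case True
      have "p r = k \<longleftrightarrow> r = i" for r
        using True p by (metis bij_pointE)
      then show ?thesis using True by (intro prod.cong) auto
    next
      case False
      obtain r where "p r = k" using p by (metis bij_pointE)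
      then have "prod ?R UNIV = 0" "prod ?L UNIV = 0"
        using False by (auto intro!: prod_zero)
      then show ?thesis by simp
    qed
    then show "(\<Prod>r\<in>UNIV. (\<chi> r c. if c = k then if r = i then 1 else 0 else A $ r $ c) $ r $ p r)
        = (\<Prod>r\<in>UNIV. (\<chi> r c. if r = i then if c = k then 1 else 0 else A $ r $ c) $ r $ p r)"
      by simp
  qed
  also have "\<dots> = cofactor A i k"
    unfolding cofactor_def by (rule arg_cong[where f = det]) (simp add: vec_eq_iff axis_def)
  finally show ?thesis .
qed

lemma sum_column_mult_cofactor:
  fixes A :: "'a::comm_ring_1^'n::finite^'n"
  shows "(\<Sum>i\<in>UNIV. A $ i $ j * cofactor A i k) = (if j = k then det A else 0)"
proof -
  have "transpose A $ j $ i = A $ i $ j" for i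
    by (simp add: transpose_def)
  then show ?thesis
    using sum_row_mult_cofactor[of "transpose A" j k] by (simp add: cofactor_transpose)
qed

text \<open>Cramer's rule without division, valid over the polynomial ring: it yields the numerators
  of the coefficients of \<open>y\<close> in the rows of \<open>A\<close>.\<close>

lemma cramer_rows:
  fixes A :: "'a::comm_ring_1^'n::finite^'n"
  shows "(\<Sum>i\<in>UNIV. det (\<chi> r. if r = i then y else A $ r) * A $ i $ j) = det A * y $ j"
proof -
  have "(\<Sum>i\<in>UNIV. det (\<chi> r. if r = i then y else A $ r) * A $ i $ j)
      = (\<Sum>i\<in>UNIV. \<Sum>k\<in>UNIV. y $ k * (A $ i $ j * cofactor A i k))"
    by (simp add: det_replace_row sum_distrib_right sum_distrib_left mult_ac)
  also have "\<dots> = (\<Sum>k\<in>UNIV. y $ k * (\<Sum>i\<in>UNIV. A $ i $ j * cofactor A i k))"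
    by (subst sum.swap) (simp add: sum_distrib_left)
  also have "\<dots> = det A * y $ j"
    by (simp add: sum_column_mult_cofactor if_distrib cong: if_cong)
  finally show ?thesis .
qed

text \<open>Multiplying a dependency of the rows by the adjugate isolates each coefficient times the
  determinant; this gives uniqueness of coefficients.\<close>

lemma row_combination_zero_imp_mult_det:
  fixes A :: "'a::comm_ring_1^'n::finite^'n"
  assumes "\<And>j. (\<Sum>r\<in>UNIV. d r * A $ r $ j) = 0"
  shows "d i * det A = 0"
proof -
  have "d i * det A = (\<Sum>r\<in>UNIV. d r * (\<Sum>j\<in>UNIV. A $ r $ j * cofactor A i j))"
    by (simp add: sum_row_mult_cofactor if_distrib cong: if_cong)
  also have "\<dots> = (\<Sum>j\<in>UNIV. (\<Sum>r\<in>UNIV. d r * A $ r $ j) * cofactor A i j)"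
    unfolding sum_distrib_left sum_distrib_right
    by (subst sum.swap) (simp add: mult.assoc)
  finally show ?thesis using assms by simp
qed

lemma det_mat_1_replace_row:
  fixes l :: "'a::comm_ring_1^'n::finite"
  shows "det (\<chi> i. if i = k then l else axis i 1) = l $ k"
proof -
  have I: "(mat 1 :: 'a^'n^'n) $ r = axis r 1" for r
    by (simp add: mat_def axis_def vec_eq_iff)
  have "det (\<chi> i. if i = k then l else axis i 1) = (\<Sum>j\<in>UNIV. l $ j * cofactor (mat 1) k j)"
    by (simp add: det_replace_row[symmetric] I cong: if_cong)
  also have "\<dots> = (\<Sum>j\<in>UNIV. l $ j * (if j = k then 1 else 0))"
  proof (intro sum.cong refl arg_cong2[where f = "(*)"])
    fix j
    \<comment> \<open>Row \<open>j\<close> of the identity is a unit vector, so the orthogonality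
      relation collapses to one cofactor.\<close>
    have "(\<Sum>i\<in>UNIV. (mat 1 :: 'a^'n^'n) $ j $ i * cofactor (mat 1) k i)
        = (\<Sum>i\<in>UNIV. if i = j then cofactor (mat 1) k i else 0)"
      by (rule sum.cong) (auto simp: I axis_def)
    then show "cofactor (mat 1 :: 'a^'n^'n) k j = (if j = k then 1 else 0)"
      using sum_row_mult_cofactor[of "mat 1 :: 'a^'n^'n" j k] by (metis (no_types) det_I sum.delta finite UNIV_I)
  qed
  finally show ?thesis by (simp add: if_distrib cong: if_cong)
qed

text \<open>The multiples of \<open>l\<close> are added one row at a time, \<open>S\<close> being
  the rows already changed; linearity in the new row \<open>k\<close> adds \<open>a k\<close> times
  a determinant with row \<open>l\<close>.\<close>

lemma det_rank_one_update:
  fixes l :: "'a::comm_ring_1^'n::finite"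
  shows "det (\<chi> i. axis i 1 + a i *s l) = 1 + (\<Sum>i\<in>UNIV. l $ i * a i)"
proof -
  define c where "c S i = axis i 1 + (if i \<in> S then a i else 0) *s l" for S i
  \<comment> \<open>With \<open>l\<close> itself in row \<open>k\<close>, the multiples of
    \<open>l\<close> in the other rows are removable by row operations.\<close>
  have replace: "det (\<chi> i. if i = k then l else c T i) = l $ k" if "finite T" "k \<notin> T" for k T
    using that
  proof (induct T)
    case empty
    then show ?case by (simp add: c_def det_mat_1_replace_row cong: if_cong)
  next
    case (insert t T)
    let ?A = "\<chi> i. if i = k then l else c T i"
    have "(\<chi> i. if i = k then l else c (insert t T) i)
        = (\<chi> i. if i = t then row t ?A + a t *s row k ?A else row i ?A)"
      using insert by (auto simp: vec_eq_iff row_def c_def)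
    then show ?case using insert det_row_operation[of t k ?A "a t"] by auto
  qed
  have "det (\<chi> i. c S i) = 1 + (\<Sum>i\<in>S. l $ i * a i)" if "finite S" for S
    using that
  proof (induct S)
    case empty
    have "(\<chi> i. c {} i) = mat 1" by (simp add: c_def mat_def axis_def vec_eq_iff)
    then show ?case by simp
  next
    case (insert k S)
    have "(\<chi> i. c (insert k S) i) = (\<chi> i. if i = k then axis k 1 + a k *s l else c S i)"
      by (auto simp: vec_eq_iff c_def)
    moreover have "(\<chi> i. if i = k then axis k 1 else c S i) = (\<chi> i. c S i)"
      using insert by (auto simp: vec_eq_iff c_def)
    ultimately show ?case
      using insert by (simp add: det_row_add det_row_mul replace mult.commute)
  qed
  from this[of UNIV] show ?thesis by (simp add: c_def)
qed

section \<open>Hyperplanes and the matrices that fix them\<close>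

lemma lform_linear:
  "lform l (v + w) = lform l v + lform l w" "lform l (c *s v) = c * lform l v"
  "lform l (v - w) = lform l v - lform l w" "lform l 0 = 0"
  by (simp_all add: lform_def algebra_simps sum.distrib sum_subtractf sum_distrib_left)

lemma lform_axis: "lform l (axis j 1) = l $ j"
  by (simp add: lform_def axis_def if_distrib cong: if_cong)

lemma matrix_vector_mult_axis:
  fixes g :: "'a::comm_ring_1^'n::finite^'m"
  shows "(g *v axis j 1) $ i = g $ i $ j"
  by (simp add: matrix_vector_mult_def axis_def if_distrib cong: if_cong)

lemma lform_nonzero_obtains:
  fixes l :: "'a::field^'n::finite"
  assumes "l \<noteq> 0"
  obtains u where "lform l u = 1"
proof -
  obtain k where "l $ k \<noteq> 0" using assms by (auto simp: vec_eq_iff)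
  then have "lform l (inverse (l $ k) *s axis k 1) = 1"
    by (simp only: lform_linear lform_axis) simp
  then show thesis by (rule that)
qed

lemma subspace_lform_kernel: "vec.subspace {v. lform l v = 0}"
  by (simp add: vec.subspace_def lform_linear)

text \<open>A nonzero row of \<open>s - mat 1\<close> is a linear form vanishing on the fixed space;
  its kernel is proper, so equality follows by dimension.\<close>

lemma hyperplane_fixspace:
  fixes s :: "'a::field^'n::finite^'n"
  assumes "vec.dim (fixspace s) = CARD('n) - 1"
  obtains l where "l \<noteq> 0" "fixspace s = {v. lform l v = 0}"
proof -
  have dU: "vec.dim (UNIV :: ('a^'n) set) = CARD('n)"
    by (simp add: card_cart_basis)
  have "s \<noteq> mat 1"
  proof
    assume "s = mat 1"
    then have "fixspace s = UNIV" by (simp add: fixspace_def)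
    then have "CARD('n) = CARD('n) - 1" using assms dU by simp
    \<comment> \<open>Natural subtraction truncates, so the contradiction needs a positive
      dimension.\<close>
    moreover have "CARD('n) > 0" by simp
    ultimately show False by linarith
  qed
  then obtain i where i: "row i (s - mat 1) \<noteq> 0"
    by (auto simp: vec_eq_iff row_def)
  let ?l = "row i (s - mat 1)"
  have "lform ?l v = ((s - mat 1) *v v) $ i" for v
    by (simp add: lform_def row_def matrix_vector_mult_def)
  then have "lform ?l v = (s *v v - v) $ i" for v
    by (simp add: matrix_vector_mult_diff_rdistrib)
  then have sub: "fixspace s \<subseteq> {v. lform ?l v = 0}"
    by (auto simp: fixspace_def)
  have "vec.subspace (fixspace s)"
    by (auto simp: vec.subspace_def fixspace_def matrix_vector_right_distrib vector_scalar_commute)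
  moreover have "vec.dim {v. lform ?l v = 0} \<le> vec.dim (fixspace s)"
  proof -
    obtain u where "lform ?l u = 1" using lform_nonzero_obtains[OF i] .
    then have "{v. lform ?l v = 0} \<noteq> UNIV" by (metis (mono_tags) UNIV_I mem_Collect_eq zero_neq_one)
    then have "vec.dim {v. lform ?l v = 0} < vec.dim (UNIV :: ('a^'n) set)"
      using vec.subspace_dim_equal[OF subspace_lform_kernel vec.subspace_UNIV subset_UNIV]
      by (metis not_le)
    then show ?thesis using assms dU by linarith
  qed
  ultimately have "fixspace s = {v. lform ?l v = 0}"
    using vec.subspace_dim_equal[OF _ subspace_lform_kernel sub] by blast
  with i show thesis by (rule that)
qed

lemma matrix_inv_mult:
  fixes g :: "'a::field^'n::finite^'n"
  assumes "invertible g"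
  shows "g ** matrix_inv g = mat 1" "matrix_inv g ** g = mat 1"
  using assms someI_ex[of "\<lambda>B. g ** B = mat 1 \<and> B ** g = mat 1"]
  unfolding matrix_inv_def invertible_def by blast+

lemma det_matrix_inv:
  fixes g :: "'a::field^'n::finite^'n"
  assumes "invertible g"
  shows "det (matrix_inv g) = inverse (det g)"
proof -
  have "det (matrix_inv g) * det g = 1"
    using matrix_inv_mult(2)[OF assms] by (metis det_I det_mul)
  then show ?thesis by (metis inverse_unique mult.commute)
qed

text \<open>This covers the identity, diagonalisable reflections and transvections uniformly, hence
  every element of \<open>GH G H\<close>.\<close>

locale hyperplane_fixing =
  fixes l :: "'a::field^'n::finite" and g :: "'a^'n^'n"
  assumes l_nonzero: "l \<noteq> 0"
    and invertible_g: "invertible g"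
    and fixes_kernel: "lform l v = 0 \<Longrightarrow> g *v v = v"
begin

text \<open>If \<open>lform l u = 1\<close>, then \<open>v - lform l v *s u\<close> lies in the
  fixed kernel, which forces the root \<open>g *v u - u\<close>.\<close>

lemma obtains_root:
  obtains \<alpha> where "\<And>v. g *v v = v + lform l v *s \<alpha>"
proof -
  obtain u where u: "lform l u = 1" using lform_nonzero_obtains[OF l_nonzero] .
  have "g *v v = v + lform l v *s (g *v u - u)" for v
  proof -
    have "g *v (v - lform l v *s u) = v - lform l v *s u"
      by (rule fixes_kernel) (simp add: lform_linear u)
    then show ?thesis
      by (simp add: matrix_vector_mult_diff_distrib vector_scalar_commute algebra_simps
          vector_ssub_ldistrib)
  qed
  then show thesis by (rule that)
qed

lemma matrix_inv: "hyperplane_fixing l (matrix_inv g)"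
proof
  show "l \<noteq> 0" by (rule l_nonzero)
  show "invertible (matrix_inv g)"
    using matrix_inv_mult[OF invertible_g] invertible_def by blast
  show "matrix_inv g *v v = v" if "lform l v = 0" for v
    using fixes_kernel[OF that] matrix_inv_mult(2)[OF invertible_g]
    by (metis matrix_vector_mul_assoc matrix_vector_mul_lid)
qed

text \<open>In coordinates \<open>g\<close> is the identity plus a rank-one matrix. Rows are the
  useful format because \<open>pact\<close> substitutes rows of the inverse.\<close>

lemma obtains_rows:
  obtains \<alpha> where "\<And>j. row j g = axis j 1 + \<alpha> $ j *s l" "det g = 1 + lform l \<alpha>"
proof -
  obtain \<alpha> where \<alpha>: "\<And>v. g *v v = v + lform l v *s \<alpha>" using obtains_root by blast
  have rows: "row i g = axis i 1 + \<alpha> $ i *s l" for i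
  proof -
    have "g $ i $ j = axis i 1 $ j + \<alpha> $ i * l $ j" for j
    proof -
      have "g $ i $ j = (g *v axis j 1) $ i"
        by (simp add: matrix_vector_mult_axis)
      then show ?thesis by (simp add: \<alpha> lform_axis mult.commute) (simp add: axis_def)
    qed
    then show ?thesis by (simp add: vec_eq_iff row_def)
  qed
  then have "g = (\<chi> i. axis i 1 + \<alpha> $ i *s l)"
    by (simp add: vec_eq_iff row_def)
  then have "det g = 1 + (\<Sum>i\<in>UNIV. l $ i * \<alpha> $ i)"
    by (simp add: det_rank_one_update)
  with rows show thesis by (intro that) (auto simp: lform_def)
qed

end

section \<open>The group action on polynomials and forms\<close>

lemma pact_mult: "pact g (f * f') = pact g f * pact g f'"
  by (simp add: pact_def psubst_mult)

lemma pact_sum: "pact g (sum f A) = (\<Sum>i\<in>A. pact g (f i))"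
  by (simp add: pact_def psubst_sum)

lemma pact_prod: "pact g (prod f A) = (\<Prod>i\<in>A. pact g (f i))"
  by (simp add: pact_def psubst_prod)

lemma pact_pconst: "pact g (pconst c) = pconst c"
  by (simp add: pact_def psubst_pconst)

lemma pact_power: "pact g (f ^ k) = pact g f ^ k"
  using pact_prod[of g "\<lambda>_. f" "{..<k}"] by simp

lemma pact_det: "pact g (det A) = det (\<chi> i j. pact g (A $ i $ j))"
  by (simp add: det_def pact_sum pact_mult pact_prod pact_pconst flip: pconst_of_int)

lemma pconst_det: "pconst (det A) = det (\<chi> i j. pconst (A $ i $ j))"
  by (simp add: det_def pconst_sum pconst_mult pconst_prod pconst_of_int)

definition contract :: "('a::comm_ring_1, 'n::finite) form1 \<Rightarrow> 'a^'n \<Rightarrow> ('a, 'n) mpoly" where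
  "contract w v = (\<Sum>j\<in>UNIV. w j * pconst (v $ j))"

lemma contract_add: "contract w (u + v) = contract w u + contract w v"
  by (simp add: contract_def pconst_add distrib_left sum.distrib)

lemma contract_axis: "contract w (axis j 1) = w j"
proof -
  have "contract w (axis j 1) = (\<Sum>i\<in>UNIV. if i = j then w j else 0)"
    unfolding contract_def by (rule sum.cong) (auto simp: axis_def pconst_zero pconst_one)
  then show ?thesis by simp
qed

text \<open>The inverse matrix acting on the differentials cancels against
  \<open>g *v v\<close>.\<close>

lemma contract_invariant:
  assumes "fact1 g w = w" "invertible g"
  shows "contract w (g *v v) = pact g (contract w v)"
proof -
  have "contract w (g *v v)
      = (\<Sum>k\<in>UNIV. \<Sum>j\<in>UNIV. pact g (w j) * pconst (matrix_inv g $ j $ k * (g *v v) $ k))"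
    by (subst assms(1)[symmetric])
      (simp add: contract_def fact1_def sum_distrib_right pconst_mult mult.assoc)
  also have "\<dots> = (\<Sum>j\<in>UNIV. pact g (w j) * pconst ((matrix_inv g *v (g *v v)) $ j))"
    by (subst sum.swap) (simp add: matrix_vector_mult_def[of "matrix_inv g"] pconst_sum sum_distrib_left)
  also have "matrix_inv g *v (g *v v) = v"
    using matrix_inv_mult(2)[OF assms(2)] by (simp add: matrix_vector_mul_assoc)
  finally show ?thesis
    by (simp add: contract_def pact_sum pact_mult pact_pconst)
qed

text \<open>On unit vectors, invariance says that \<open>g\<close> acts on the coefficient matrix as
  right multiplication by \<open>g\<close>.\<close>

lemma pact_wedge_coeff:
  fixes \<omega> :: "'n::finite \<Rightarrow> ('a::field, 'n) form1"
  assumes "\<And>i. fact1 g (\<omega> i) = \<omega> i" "invertible g"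
  shows "pact g (wedge_coeff \<omega>) = pconst (det g) * wedge_coeff \<omega>"
proof -
  have "pact g (\<omega> i j) = (\<Sum>k\<in>UNIV. \<omega> i k * pconst (g $ k $ j))" for i j
    using contract_invariant[OF assms(1)[of i] assms(2), of "axis j 1"]
    by (simp add: contract_axis) (simp add: contract_def matrix_vector_mult_axis)
  then have "(\<chi> i j. pact g (\<omega> i j)) = (\<chi> i j. \<omega> i j) ** (\<chi> i j. pconst (g $ i $ j))"
    by (simp add: vec_eq_iff matrix_matrix_mult_def)
  then show ?thesis
    by (simp add: wedge_coeff_def pact_det pconst_det det_mul mult.commute)
qed

text \<open>After a constant change of basis extending \<open>S\<close>, each vector of
  \<open>S\<close> yields a line of the matrix with common factor \<open>p\<close>.\<close>

lemma power_card_dvd_wedge_coeff: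
  fixes \<omega> :: "'n::finite \<Rightarrow> ('a::field, 'n) form1"
  assumes ind: "vec.independent S" and dvd: "\<And>i v. v \<in> S \<Longrightarrow> p dvd contract (\<omega> i) v"
  shows "p ^ card S dvd wedge_coeff \<omega>"
proof -
  obtain B where B: "S \<subseteq> B" "vec.independent B" "UNIV \<subseteq> vec.span B"
    using vec.maximal_independent_subset_extend[OF subset_UNIV ind] by metis
  have "card B = vec.dim (UNIV :: ('a^'n) set)"
    by (rule vec.basis_card_eq_dim) (use B in auto)
  then have "card B = CARD('n)" by (simp add: card_cart_basis)
  then obtain b where b: "bij_betw b (UNIV :: 'n set) B"
    using finite_same_card_bij[OF finite vec.finiteI_independent[OF B(2)]] by metis
  define P where "P = (\<chi> j. b j)"
  have "rows P = B"
    using b by (auto simp: rows_def row_def P_def bij_betw_def)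
  then have "invertible P"
    using B(3) by (auto simp: invertible_left_inverse matrix_left_invertible_span_rows_gen)
  then have det_P: "det P \<noteq> 0" by (simp add: invertible_det_nz)
  have "\<exists>q. contract (\<omega> i) (b j) = (if b j \<in> S then p else 1) * q" for i j
    using dvd[of "b j" i] by (auto simp: dvd_def)
  then obtain q where q: "\<And>i j. contract (\<omega> i) (b j) = (if b j \<in> S then p else 1) * q i j"
    by metis
  \<comment> \<open>Row \<open>j\<close> of \<open>P\<close> is the basis vector \<open>b j\<close>,
    so row \<open>j\<close> of the product holds the contractions with \<open>b j\<close>.\<close>
  have "(\<chi> i j. pconst (P $ i $ j)) ** transpose (\<chi> i j. \<omega> i j)
      = (\<chi> j. (if b j \<in> S then p else 1) *s (\<chi> i. q i j))"
    using q by (simp add: vec_eq_iff matrix_matrix_mult_def transpose_def P_def mult.commute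
        flip: contract_def)
  from arg_cong[OF this, of det] have "pconst (det P) * wedge_coeff \<omega> = (\<Prod>j\<in>UNIV. if b j \<in> S then p else 1) * det (\<chi> j. \<chi> i. q i j)"
    by (simp only: det_mul det_rows_mul det_transpose pconst_det wedge_coeff_def)
  also have "(\<Prod>j\<in>UNIV. if b j \<in> S then p else 1) = (\<Prod>v\<in>B. if v \<in> S then p else 1)"
    by (rule prod.reindex_bij_betw[OF b])
  also have "\<dots> = p ^ card S"
    using B(1) vec.finiteI_independent[OF B(2)]
    by (simp add: prod.If_cases Int_absorb1)
  finally have "p ^ card S dvd pconst (det P) * wedge_coeff \<omega>" by simp
  then have "p ^ card S dvd pconst (inverse (det P)) * (pconst (det P) * wedge_coeff \<omega>)"
    by (rule dvd_mult)
  then show ?thesis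
    using pconst_inverse_cancel[of "inverse (det P)" "wedge_coeff \<omega>"] det_P by simp
qed

context hyperplane_fixing
begin

text \<open>Substitution adds \<open>lform l \<beta>\<close> times \<open>lpoly l\<close>, with
  \<open>\<beta>\<close> the root of the inverse, and \<open>1 + lform l \<beta>\<close> is the
  determinant of that inverse.\<close>

lemma pact_lpoly: "pact g (lpoly l) = pconst (inverse (det g)) * lpoly l"
proof -
  obtain \<beta> where \<beta>: "\<And>j. row j (matrix_inv g) = axis j 1 + \<beta> $ j *s l"
      "det (matrix_inv g) = 1 + lform l \<beta>"
    using hyperplane_fixing.obtains_rows[OF matrix_inv] by blast
  have "pact g (lpoly l) = (\<Sum>i\<in>UNIV. pconst (l $ i) * zvar i) + (\<Sum>i\<in>UNIV. pconst (l $ i * \<beta> $ i)) * lpoly l"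
    by (simp add: pact_def psubst_lpoly \<beta> lpoly_add lpoly_smult lpoly_axis distrib_left
        sum.distrib sum_distrib_right pconst_mult mult.assoc)
  also have "\<dots> = pconst (1 + lform l \<beta>) * lpoly l"
    by (simp add: lform_def pconst_sum pconst_add pconst_one distrib_right lpoly_def[symmetric])
  finally show ?thesis
    by (simp add: det_matrix_inv[OF invertible_g] flip: \<beta>(2))
qed

lemma lpoly_dvd_pact_diff: "lpoly l dvd pact g f - f"
  unfolding pact_def
proof (rule dvd_psubst_diff)
  fix k
  obtain \<beta> where "\<And>j. row j (matrix_inv g) = axis j 1 + \<beta> $ j *s l"
    using hyperplane_fixing.obtains_rows[OF matrix_inv] by blast
  then show "lpoly l dvd lpoly (row k (matrix_inv g)) - zvar k"
    by (simp add: lpoly_add lpoly_smult lpoly_axis)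
qed

text \<open>Writing \<open>f = l\<^sup>k h\<close>, the group element multiplies \<open>l\<^sup>k\<close> by \<open>(det g)\<^sup>-\<^sup>k\<close> and fixes \<open>h\<close> modulo \<open>l\<close>;
  so a semi-invariant of a different weight forces \<open>l\<close> to divide \<open>h\<close>.\<close>

lemma semi_invariant_dvd_step:
  assumes "lpoly l ^ k dvd f" "pact g f = pconst \<mu> * f" "\<mu> * det g ^ k \<noteq> 1"
  shows "lpoly l ^ Suc k dvd f"
proof -
  obtain h where h: "f = lpoly l ^ k * h" using assms(1) by (auto simp: dvd_def)
  obtain q where q: "pact g h = h + lpoly l * q"
    using lpoly_dvd_pact_diff[of h] by (metis dvdE add_diff_cancel_left' diff_add_cancel add.commute)
  have nz: "lpoly l ^ k \<noteq> 0"
    using l_nonzero lpoly_inject[of l 0] by (intro mpoly_power_nonzero) (simp add: lpoly_zero)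
  define d where "d = inverse (det g) ^ k"
  have "lpoly l ^ k * (pconst d * (h + lpoly l * q)) = lpoly l ^ k * (pconst \<mu> * h)"
    using assms(2)
    by (simp add: h pact_mult pact_power pact_lpoly power_mult_distrib d_def pconst_power q mult_ac)
  then have "pconst d * (h + lpoly l * q) = pconst \<mu> * h"
    by (rule mpoly_mult_left_cancel[OF nz])
  then have "lpoly l * (pconst d * q) = pconst (\<mu> - d) * h"
    by (simp add: pconst_diff algebra_simps)
  then have "lpoly l dvd pconst (inverse (\<mu> - d)) * (pconst (\<mu> - d) * h)"
    by (metis dvd_mult dvd_triv_left)
  moreover have "\<mu> - d \<noteq> 0"
    using assms(3) invertible_g by (auto simp: d_def invertible_det_nz power_mult_distrib[symmetric])
  ultimately have "lpoly l dvd h"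
    using pconst_inverse_cancel[of "inverse (\<mu> - d)" h] by simp
  then show ?thesis by (simp add: h mult.commute mult_dvd_mono)
qed

end

section \<open>Powers in finite sets of field elements\<close>

lemma exists_power_neq_1:
  fixes A :: "'a::field set"
  assumes "0 < k" "k < card A"
  obtains a where "a \<in> A" "a ^ k \<noteq> 1"
proof -
  let ?p = "monom (1::'a) k - 1"
  have deg: "degree ?p = k"
    using assms(1) by (subst diff_conv_add_uminus, subst degree_add_eq_left) (auto simp: degree_monom_eq)
  then have p: "?p \<noteq> 0" using assms(1) by auto
  \<comment> \<open>A nonzero polynomial of degree \<open>k\<close> has at most \<open>k\<close>
    roots, fewer than \<open>card A\<close>.\<close>
  have "\<not> A \<subseteq> {x. poly ?p x = 0}"
  proof
    assume "A \<subseteq> {x. poly ?p x = 0}"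
    then have "card A \<le> card {x. poly ?p x = 0}"
      by (rule card_mono[OF poly_roots_finite[OF p]])
    then show False using card_poly_roots_bound[OF p] deg assms(2) by linarith
  qed
  then show thesis using that by (auto simp: poly_monom)
qed

text \<open>Multiplication by \<open>a\<close> permutes \<open>A\<close>, so the nonzero product
  over \<open>A\<close> can be cancelled.\<close>

lemma power_card_eq_1:
  fixes A :: "'a::field set"
  assumes "finite A" "0 \<notin> A" "\<And>x y. x \<in> A \<Longrightarrow> y \<in> A \<Longrightarrow> x * y \<in> A" "a \<in> A"
  shows "a ^ card A = 1"
proof -
  have a: "a \<noteq> 0" using assms by auto
  have "(*) a ` A = A"
    by (rule endo_inj_surj) (use assms a in \<open>auto simp: inj_on_def\<close>)
  then have "(\<Prod>x\<in>A. x) = (\<Prod>x\<in>A. a * x)"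
    by (metis (no_types, lifting) a inj_onI mult_left_cancel prod.reindex_cong)
  also have "\<dots> = a ^ card A * (\<Prod>x\<in>A. x)" by (simp add: prod.distrib)
  finally show ?thesis using assms by simp
qed

section \<open>Divisibility along a reflecting hyperplane\<close>

locale reflecting_hyperplane =
  fixes G :: "('a::field^'n::finite^'n) set" and H :: "('a^'n) set"
  assumes finite_G: "finite G"
    and group_G: "matrix_group G"
    and reflecting: "H \<in> refl_hyperplanes G"
begin

lemma lH_spec: "lH H \<noteq> 0" "H = {v. lform (lH H) v = 0}"
proof -
  obtain s where "H = fixspace s" "vec.dim (fixspace s) = CARD('n) - 1"
    using reflecting by (auto simp: refl_hyperplanes_def is_reflection_def)
  then have "\<exists>l. l \<noteq> 0 \<and> H = {v. lform l v = 0}"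
    using hyperplane_fixspace by metis
  from someI_ex[OF this] show "lH H \<noteq> 0" "H = {v. lform (lH H) v = 0}"
    unfolding lH_def by blast+
qed

lemma invertible_GH: "g \<in> GH G H \<Longrightarrow> invertible g"
  using group_G by (auto simp: GH_def matrix_group_def)

lemma hyperplane_fixing_GH:
  assumes "g \<in> GH G H"
  shows "hyperplane_fixing (lH H) g"
proof
  show "g *v v = v" if "lform (lH H) v = 0" for v
    using assms that lH_spec(2) by (auto simp: GH_def)
qed (use assms invertible_GH lH_spec in auto)

lemma mat_1_GH: "mat 1 \<in> GH G H"
proof -
  obtain g where "g \<in> G" "invertible g" "matrix_inv g \<in> G"
    using group_G by (auto simp: matrix_group_def)
  then have "mat 1 \<in> G"
    using group_G matrix_inv_mult by (metis matrix_group_def)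
  then show ?thesis by (simp add: GH_def)
qed

lemma mult_GH: "g \<in> GH G H \<Longrightarrow> h \<in> GH G H \<Longrightarrow> g ** h \<in> GH G H"
  using group_G by (auto simp: GH_def matrix_group_def matrix_vector_mul_assoc[symmetric])

lemma matrix_inv_GH:
  assumes "g \<in> GH G H"
  shows "matrix_inv g \<in> GH G H"
proof -
  have "matrix_inv g *v v = v" if "v \<in> H" for v
    using hyperplane_fixing.fixes_kernel[OF hyperplane_fixing.matrix_inv[OF hyperplane_fixing_GH[OF assms]]]
      that lH_spec(2) by blast
  then show ?thesis
    using assms group_G by (auto simp: GH_def matrix_group_def)
qed

lemma finite_GH: "finite (GH G H)"
  using finite_G by (simp add: GH_def)

text \<open>The fibres of \<open>det\<close> are cosets of \<open>KH G H\<close>, so the division in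
  \<open>eH\<close> is exact and counts determinant values.\<close>

lemma card_det_GH: "card (det ` GH G H) = eH G H"
proof -
  have fiber: "card {g \<in> GH G H. det g = a} = card (KH G H)" if a: "a \<in> det ` GH G H" for a
  proof -
    obtain h where h: "h \<in> GH G H" "a = det h" using a by blast
    have "det h \<noteq> 0" using invertible_GH[OF h(1)] by (simp add: invertible_det_nz)
    have inv: "matrix_inv h ** (h ** g) = g" "h ** (matrix_inv h ** g) = g" for g
      using matrix_inv_mult[OF invertible_GH[OF h(1)]] by (simp_all add: matrix_mul_assoc)
    have "bij_betw ((**) h) (KH G H) {g \<in> GH G H. det g = a}"
      by (rule bij_betw_byWitness[where f' = "(**) (matrix_inv h)"])
        (use h \<open>det h \<noteq> 0\<close> in \<open>auto simp: inv KH_def mult_GH matrix_inv_GH det_mul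
          det_matrix_inv[OF invertible_GH]\<close>)
    then show ?thesis by (simp add: bij_betw_same_card)
  qed
  have "card (GH G H) = (\<Sum>a\<in>det ` GH G H. card {g \<in> GH G H. det g = a})"
    using sum.image_gen[OF finite_GH, of "\<lambda>_. 1::nat" det] by simp
  also have "\<dots> = card (det ` GH G H) * card (KH G H)"
    using fiber by simp
  finally have "card (GH G H) = card (det ` GH G H) * card (KH G H)" .
  moreover have "card (KH G H) > 0"
    using mat_1_GH finite_GH by (auto simp: KH_def card_gt_0_iff)
  ultimately show ?thesis by (simp add: eH_def)
qed

lemma exists_det_power_neq_1:
  assumes "0 < k" "k < eH G H"
  obtains g where "g \<in> GH G H" "det g ^ k \<noteq> 1"
proof -
  have "k < card (det ` GH G H)" using assms(2) by (simp add: card_det_GH)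
  then obtain a where "a \<in> det ` GH G H" "a ^ k \<noteq> 1"
    using exists_power_neq_1[OF assms(1)] by blast
  then show thesis using that by blast
qed

lemma det_power_eH: "g \<in> GH G H \<Longrightarrow> det g ^ eH G H = 1"
  unfolding card_det_GH[symmetric]
proof (rule power_card_eq_1)
  show "0 \<notin> det ` GH G H"
    using invertible_GH by (auto simp: invertible_det_nz)
  show "x * y \<in> det ` GH G H" if "x \<in> det ` GH G H" "y \<in> det ` GH G H" for x y
    using that mult_GH by (auto simp flip: det_mul)
qed (simp_all add: finite_GH)

text \<open>Evaluation at a vector with \<open>lform\<close> value 1 shows the root is unique, so
  the description in \<open>root_vec\<close> is well defined.\<close>

lemma root_vec_spec:
  assumes "s \<in> GH G H"
  shows "s *v v = v + lform (lH H) v *s root_vec H s"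
proof -
  obtain \<alpha> where \<alpha>: "\<And>v. s *v v = v + lform (lH H) v *s \<alpha>"
    using hyperplane_fixing.obtains_root[OF hyperplane_fixing_GH[OF assms]] by blast
  obtain u where u: "lform (lH H) u = 1"
    using lform_nonzero_obtains[OF lH_spec(1)] .
  have "root_vec H s = \<alpha>"
    unfolding root_vec_def
  proof (rule the_equality)
    show "\<beta> = \<alpha>" if "\<forall>v. s *v v = v + lform (lH H) v *s \<beta>" for \<beta>
      using that[rule_format, of u] \<alpha>[of u] u by simp
  qed (use \<alpha> in auto)
  then show ?thesis using \<alpha> by simp
qed

lemma lpoly_power_eH_dvd_contract_root:
  assumes w: "inv_form G w" and s: "s \<in> GH G H" "is_transvection H s"
  shows "lpoly (lH H) ^ eH G H dvd contract w (root_vec H s)"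
proof -
  have act: "contract w (g *v v) = pact g (contract w v)" if "g \<in> GH G H" for g v
    using w that invertible_GH[OF that] by (intro contract_invariant) (auto simp: inv_form_def GH_def)
  obtain u where u: "lform (lH H) u = 1"
    using lform_nonzero_obtains[OF lH_spec(1)] .
  have "pact s (contract w u) - contract w u = contract w (root_vec H s)"
    by (simp add: act[OF s(1), symmetric] root_vec_spec[OF s(1)] u contract_add)
  then have base: "lpoly (lH H) dvd contract w (root_vec H s)"
    using hyperplane_fixing.lpoly_dvd_pact_diff[OF hyperplane_fixing_GH[OF s(1)]] by metis
  \<comment> \<open>The root of a transvection lies in \<open>H\<close>, so all of
    \<open>GH G H\<close> fixes it.\<close>
  have inv: "pact g (contract w (root_vec H s)) = pconst 1 * contract w (root_vec H s)"
    if "g \<in> GH G H" for g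
    using that s(2) act[OF that, of "root_vec H s"]
    by (simp add: pconst_one is_transvection_def GH_def)
  have "lpoly (lH H) ^ k dvd contract w (root_vec H s)" if "k \<le> eH G H" for k
    using that
  proof (induct k)
    case (Suc k)
    show ?case
    \<comment> \<open>At exponent 0 every determinant power is 1 and the weight argument says
      nothing; the first factor comes from \<open>base\<close>.\<close>
    proof (cases "k = 0")
      case False
      then obtain g where g: "g \<in> GH G H" "det g ^ k \<noteq> 1"
        using Suc exists_det_power_neq_1[of k] by auto
      show ?thesis
        by (rule hyperplane_fixing.semi_invariant_dvd_step[OF hyperplane_fixing_GH[OF g(1)] _ inv[OF g(1)]])
          (use Suc g in auto)
    qed (use base in simp)
  qed simp
  then show ?thesis by simp
qed

lemma lpoly_power_dvd_wedge_coeff: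
  assumes inv: "\<And>i. inv_form G (\<omega> i)"
  shows "lpoly (lH H) ^ (eH G H * bH G H + (eH G H - 1)) dvd wedge_coeff \<omega>"
proof -
  let ?R = "{root_vec H s | s. s \<in> GH G H \<and> is_transvection H s}"
  \<comment> \<open>The basis is chosen among the roots themselves, since the divisibility is known
    for actual roots.\<close>
  obtain S where S: "S \<subseteq> ?R" "vec.independent S" "?R \<subseteq> vec.span S" "card S = vec.dim ?R"
    by (rule vec.basis_exists)
  then have "card S = bH G H" by (simp add: bH_def)
  moreover have "(lpoly (lH H) ^ eH G H) ^ card S dvd wedge_coeff \<omega>"
    by (rule power_card_dvd_wedge_coeff[OF S(2)])
      (use S(1) lpoly_power_eH_dvd_contract_root[OF inv] in auto)
  ultimately have base: "lpoly (lH H) ^ (eH G H * bH G H) dvd wedge_coeff \<omega>"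
    by (simp add: power_mult)
  have "lpoly (lH H) ^ (eH G H * bH G H + k) dvd wedge_coeff \<omega>" if "k \<le> eH G H - 1" for k
    using that
  proof (induct k)
    case (Suc k)
    then have "Suc k < eH G H" by linarith
    then obtain g where g: "g \<in> GH G H" "det g ^ Suc k \<noteq> 1"
      using exists_det_power_neq_1[of "Suc k"] by blast
    have "pact g (wedge_coeff \<omega>) = pconst (det g) * wedge_coeff \<omega>"
      using g(1) inv invertible_GH[OF g(1)]
      by (intro pact_wedge_coeff) (auto simp: inv_form_def GH_def)
    \<comment> \<open>Powers with exponent a multiple of \<open>eH G H\<close> are trivial, and the
      character \<open>det\<close> shifts the rest to \<open>det g ^ Suc k\<close>.\<close>
    moreover have "det g * det g ^ (eH G H * bH G H + k) \<noteq> 1"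
      using g det_power_eH[OF g(1)] by (simp add: power_add power_mult)
    ultimately have "lpoly (lH H) ^ Suc (eH G H * bH G H + k) dvd wedge_coeff \<omega>"
      using Suc by (intro hyperplane_fixing.semi_invariant_dvd_step[OF hyperplane_fixing_GH[OF g(1)]]) auto
    then show ?case by simp
  qed (use base in simp)
  then show ?thesis by simp
qed

end

section \<open>From single hyperplanes to their product\<close>

lemma lpoly_power_dvd_mult_cancel:
  fixes l :: "'a::field^'n::finite"
  assumes "l \<noteq> 0" "lpoly l ^ m dvd p * q" "\<not> lpoly l dvd p"
  shows "lpoly l ^ m dvd q"
  using assms(2)
proof (induct m arbitrary: q)
  case (Suc m)
  \<comment> \<open>Primality puts one factor into \<open>q\<close>; cancelling it leaves the same
    problem for \<open>r\<close> with exponent \<open>m\<close>.\<close>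
  then have "lpoly l dvd p * q" by (metis dvd_mult_left power_Suc)
  then obtain r where r: "q = lpoly l * r"
    using lpoly_dvd_mult[OF assms(1)] assms(3) by (blast elim: dvdE)
  obtain t where "p * q = lpoly l ^ Suc m * t" using Suc(2) by (auto simp: dvd_def)
  then have "lpoly l * (p * r) = lpoly l * (lpoly l ^ m * t)"
    by (simp add: r mult_ac)
  then have "p * r = lpoly l ^ m * t"
    using assms(1) lpoly_inject[of l 0] mpoly_mult_left_cancel by (metis lpoly_zero)
  then have "lpoly l ^ m dvd r" using Suc(1) by simp
  then show ?case by (simp add: r mult_dvd_mono)
qed simp

text \<open>The prime \<open>lpoly (l H)\<close> does not divide the product already split off from
  \<open>f\<close>, so its power must divide the cofactor \<open>q\<close>.\<close>

lemma prod_lpoly_power_dvd: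
  fixes l :: "'b \<Rightarrow> 'a::field^'n::finite"
  assumes "finite \<A>" "\<And>H. H \<in> \<A> \<Longrightarrow> l H \<noteq> 0"
    and distinct: "\<And>H H'. H \<in> \<A> \<Longrightarrow> H' \<in> \<A> \<Longrightarrow> H \<noteq> H' \<Longrightarrow> \<not> lpoly (l H) dvd lpoly (l H')"
    and "\<And>H. H \<in> \<A> \<Longrightarrow> lpoly (l H) ^ m H dvd f"
  shows "(\<Prod>H\<in>\<A>. lpoly (l H) ^ m H) dvd f"
  using assms
proof (induct \<A>)
  case empty
  show ?case by simp
next
  case (insert H \<A>)
  have "(\<Prod>H\<in>\<A>. lpoly (l H) ^ m H) dvd f"
  proof (rule insert(3))
    show "l H' \<noteq> 0" "lpoly (l H') ^ m H' dvd f" if "H' \<in> \<A>" for H'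
      using insert(4,6)[of H'] that by simp_all
    show "\<not> lpoly (l H') dvd lpoly (l H'')" if "H' \<in> \<A>" "H'' \<in> \<A>" "H' \<noteq> H''" for H' H''
      using insert(5)[of H' H''] that by simp
  qed
  then obtain q where q: "f = (\<Prod>H\<in>\<A>. lpoly (l H) ^ m H) * q" by (auto simp: dvd_def)
  have H: "l H \<noteq> 0" using insert(4) by blast
  have unit: "\<not> lpoly (l H) dvd 1"
  proof
    assume "lpoly (l H) dvd 1"
    moreover obtain k where k: "l H $ k \<noteq> 0" using H by (auto simp: vec_eq_iff)
    ultimately show False
      using lpoly_elimination(1)[OF k, of 1] by (simp add: psubst_one)
  qed
  have power: "\<not> lpoly (l H) dvd lpoly (l H') ^ k" if "H' \<in> \<A>" for H' k
  proof (induct k)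
    case (Suc k)
    have "\<not> lpoly (l H) dvd lpoly (l H')" using insert(2) insert(5)[of H H'] that by blast
    then show ?case using Suc lpoly_dvd_mult[OF H] by (metis power_Suc)
  qed (use unit in simp)
  have "\<not> lpoly (l H) dvd (\<Prod>H\<in>\<B>. lpoly (l H) ^ m H)" if "\<B> \<subseteq> \<A>" for \<B>
    using finite_subset[OF that insert(1)] that
  proof (induct \<B>)
    case (insert H' \<B>)
    then have "\<not> lpoly (l H) dvd lpoly (l H') ^ m H'" "\<not> lpoly (l H) dvd (\<Prod>H\<in>\<B>. lpoly (l H) ^ m H)"
      using power by simp_all
    then show ?case
      using lpoly_dvd_mult[OF H] insert(1,2) by auto
  qed (use unit in simp)
  then have "\<not> lpoly (l H) dvd (\<Prod>H\<in>\<A>. lpoly (l H) ^ m H)" by simp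
  moreover have "lpoly (l H) ^ m H dvd (\<Prod>H\<in>\<A>. lpoly (l H) ^ m H) * q"
    using insert(6)[of H] by (simp flip: q)
  ultimately have "lpoly (l H) ^ m H dvd q"
    using lpoly_power_dvd_mult_cancel[OF H] by metis
  then have "lpoly (l H) ^ m H * (\<Prod>H\<in>\<A>. lpoly (l H) ^ m H) dvd q * (\<Prod>H\<in>\<A>. lpoly (l H) ^ m H)"
    by (rule mult_dvd_mono) (rule dvd_refl)
  then show ?case
    unfolding prod.insert[OF insert(1,2)] by (subst q) (simp only: mult.commute)
qed

lemma finite_refl_hyperplanes: "finite G \<Longrightarrow> finite (refl_hyperplanes G)"
  by (rule finite_subset[of _ "fixspace ` G"]) (auto simp: refl_hyperplanes_def)

lemma Q_dvd_wedge_coeff: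
  assumes G: "finite G" "matrix_group G" and inv: "\<And>i. inv_form G (\<omega> i)"
  shows "Q_tilde G * Q_det G dvd wedge_coeff \<omega>"
proof -
  have loc: "reflecting_hyperplane G H" if "H \<in> refl_hyperplanes G" for H
    using G that by unfold_locales
  note spec = reflecting_hyperplane.lH_spec[OF loc]
  have "Q_tilde G * Q_det G
      = (\<Prod>H\<in>refl_hyperplanes G. lpoly (lH H) ^ (eH G H * bH G H + (eH G H - 1)))"
    by (simp add: Q_tilde_def Q_det_def prod.distrib power_add)
  also have "\<dots> dvd wedge_coeff \<omega>"
  proof (rule prod_lpoly_power_dvd)
    fix H H' assume H: "H \<in> refl_hyperplanes G" "H' \<in> refl_hyperplanes G" "H \<noteq> H'"
    show "\<not> lpoly (lH H) dvd lpoly (lH H')"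
    proof
      assume "lpoly (lH H) dvd lpoly (lH H')"
      then obtain c where c: "lH H' = c *s lH H"
        using lpoly_dvd_lpoly[OF spec(1)[OF H(1)]] by blast
      then have "c \<noteq> 0" using spec(1)[OF H(2)] by auto
      \<comment> \<open>Proportional forms have the same kernel, contradicting distinct
        hyperplanes.\<close>
      have "lform (lH H') v = c * lform (lH H) v" for v
        by (simp add: c lform_def sum_distrib_left mult.assoc)
      then show False using spec(2)[OF H(1)] spec(2)[OF H(2)] H(3) \<open>c \<noteq> 0\<close> by simp
    qed
  qed (use G inv spec(1) finite_refl_hyperplanes reflecting_hyperplane.lpoly_power_dvd_wedge_coeff[OF loc] in auto)
  finally show ?thesis .
qed

lemma Q_nonzero:
  assumes "finite G" "matrix_group G"
  shows "Q_tilde G * Q_det G \<noteq> 0"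
proof -
  have "lpoly (lH H) \<noteq> 0" if "H \<in> refl_hyperplanes G" for H
  proof -
    have "reflecting_hyperplane G H" using assms that by unfold_locales
    then show ?thesis
      using reflecting_hyperplane.lH_spec(1) lpoly_inject[of "lH H" 0] by (auto simp: lpoly_zero)
  qed
  then have "Q_tilde G \<noteq> 0" "Q_det G \<noteq> 0"
    unfolding Q_tilde_def Q_det_def by (auto intro!: mpoly_prod_nonzero mpoly_power_nonzero)
  then show ?thesis using mpoly_no_zero_divisors by blast
qed

text \<open>Freeness is expressed by unique invariant coefficients: existence is spanning,
  uniqueness is independence.\<close>

theorem theorem4p3:
  fixes G :: "('a::field^'n::finite^'n) set"
    and \<omega> :: "'n \<Rightarrow> ('a, 'n) form1"
    and c :: 'a
  assumes char: "(2::'a) \<noteq> 0"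
    and refl: "reflection_group G"
    and inv: "\<And>i. inv_form G (\<omega> i)"
    and c_nz: "c \<noteq> 0"
    and wedge: "wedge_coeff \<omega> = pconst c * Q_tilde G * Q_det G"
  shows "\<forall>\<eta>. inv_form G \<eta> \<longrightarrow>
           (\<exists>!f :: 'n \<Rightarrow> ('a, 'n) mpoly. (\<forall>i. inv_poly G (f i)) \<and>
               \<eta> = (\<lambda>j. \<Sum>i\<in>UNIV. f i * \<omega> i j))"
proof (intro allI impI)
  fix \<eta> :: "('a, 'n) form1" assume \<eta>: "inv_form G \<eta>"
  have G: "finite G" "matrix_group G" using refl by (auto simp: reflection_group_def)
  let ?D = "wedge_coeff \<omega>"
  have D_nz: "?D \<noteq> 0"
    using Q_nonzero[OF G] c_nz mpoly_no_zero_divisors[of "pconst c" "Q_tilde G * Q_det G"]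
    by (auto simp: wedge mult.assoc pconst_eq_0_iff)
  \<comment> \<open>The wedge of \<open>\<omega>' i\<close> is the Cramer numerator for the
    \<open>i\<close>-th coefficient of \<open>\<eta>\<close>.\<close>
  define \<omega>' where "\<omega>' i r = (if r = i then \<eta> else \<omega> r)" for i r
  have inv': "inv_form G (\<omega>' i r)" for i r
    using inv \<eta> by (simp add: \<omega>'_def)
  have "?D dvd wedge_coeff (\<omega>' i)" for i
  proof -
    obtain q where "wedge_coeff (\<omega>' i) = Q_tilde G * Q_det G * q"
      using Q_dvd_wedge_coeff[OF G, of "\<omega>' i"] inv' by (auto simp: dvd_def)
    \<comment> \<open>\<open>c\<close> is a unit, so \<open>?D\<close> divides whatever the product
      of the two \<open>Q\<close> polynomials divides.\<close>
    then have "wedge_coeff (\<omega>' i) = ?D * (pconst (inverse c) * q)"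
      using pconst_inverse_cancel[OF c_nz, of "Q_tilde G * Q_det G * q"]
      by (simp add: wedge mult_ac)
    then show ?thesis by simp
  qed
  then obtain f where f: "\<And>i. wedge_coeff (\<omega>' i) = ?D * f i"
    unfolding dvd_def by metis
  have semi: "pact g (wedge_coeff \<omega>'') = pconst (det g) * wedge_coeff \<omega>''"
    if "g \<in> G" "\<And>i. inv_form G (\<omega>'' i)" for g and \<omega>'' :: "'n \<Rightarrow> ('a, 'n) form1"
    using that G(2) by (intro pact_wedge_coeff) (auto simp: inv_form_def matrix_group_def)
  have f_inv: "inv_poly G (f i)" for i
    unfolding inv_poly_def
  proof
    fix g assume g: "g \<in> G"
    then have "det g \<noteq> 0"
      using G(2) by (simp add: matrix_group_def invertible_det_nz[symmetric])
    then have nz: "pconst (det g) * ?D \<noteq> 0"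
      using D_nz mpoly_no_zero_divisors[of "pconst (det g)" ?D] by (auto simp: pconst_eq_0_iff)
    \<comment> \<open>Numerator and denominator carry the same character \<open>det\<close>, so
      their quotient is invariant.\<close>
    have "pconst (det g) * ?D * pact g (f i) = pconst (det g) * ?D * f i"
      using semi[OF g, of "\<omega>' i"] semi[OF g, of \<omega>] inv inv' by (simp add: f pact_mult mult.assoc)
    then show "pact g (f i) = f i" by (rule mpoly_mult_left_cancel[OF nz])
  qed
  let ?M = "\<chi> i j. \<omega> i j"
  have "\<eta> j = (\<Sum>i\<in>UNIV. f i * \<omega> i j)" for j
  proof -
    have "(\<chi> r. if r = i then (\<chi> j. \<eta> j) else ?M $ r) = (\<chi> r j. \<omega>' i r j)" for i
      by (simp add: vec_eq_iff \<omega>'_def)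
    then have "(\<Sum>i\<in>UNIV. wedge_coeff (\<omega>' i) * \<omega> i j) = ?D * \<eta> j"
      using cramer_rows[of "\<chi> j. \<eta> j" ?M j] by (simp add: wedge_coeff_def)
    then have "?D * \<eta> j = ?D * (\<Sum>i\<in>UNIV. f i * \<omega> i j)"
      by (simp add: f sum_distrib_left mult.assoc)
    then show ?thesis by (rule mpoly_mult_left_cancel[OF D_nz])
  qed
  moreover have "f' = f" if "\<eta> = (\<lambda>j. \<Sum>i\<in>UNIV. f' i * \<omega> i j)" "\<eta> = (\<lambda>j. \<Sum>i\<in>UNIV. f i * \<omega> i j)" for f'
  proof
    fix i
    \<comment> \<open>Two expansions of \<open>\<eta>\<close> differ by a row dependency of a matrix
      with nonzero determinant.\<close>
    have "(\<Sum>i\<in>UNIV. (f' i - f i) * ?M $ i $ j) = 0" for j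
      using fun_cong[OF that(1), of j] fun_cong[OF that(2), of j]
      by (simp add: left_diff_distrib sum_subtractf)
    then have "(f' i - f i) * ?D = 0"
      unfolding wedge_coeff_def by (rule row_combination_zero_imp_mult_det)
    then show "f' i = f i" using D_nz mpoly_no_zero_divisors[of "f' i - f i" ?D] by auto
  qed
  ultimately show "\<exists>!f. (\<forall>i. inv_poly G (f i)) \<and> \<eta> = (\<lambda>j. \<Sum>i\<in>UNIV. f i * \<omega> i j)"
    using f_inv by (intro ex1I[of _ f]) auto
qed

end
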